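(* Let $n_z \ge n_x$ be positive integers, let $\mathcal{X} \subset \mathbb{R}^{n_x}$ be compact, let $\mathcal{O} \subset \mathbb{R}^{n_x}$ be an open set containing $\mathcal{X}$, and let $T : \mathcal{O} \to \mathbb{R}^{n_z}$ be a $C^1$ map. Define the set-valued map $T^- : T(\mathcal{X}) \rightrightarrows \mathcal{X}$ by $T^-(z) := \{x \in \mathcal{X} : T(x) = z\}$. Assume that: (1) there exists an integer $p \ge 1$ such that $\mathrm{card}(T^-(z)) = p$ for every $z \in T(\mathcal{X})$; (2) for each $x \in \mathcal{X}$, the Jacobian matrix $\frac{\partial T}{\partial x}(x)$ has full rank (i.e. rank $n_x$). Then there exists a set-valued map $T^{\rm inv} : \mathbb{R}^{n_z} \rightrightarrows \mathbb{R}^{n_x}$ that is Lipschitz with respect to the Hausdorff distance and such that $$T^{\rm inv}(z) = T^-(z) \qquad \forall z \in T(\mathcal{X}),$$ and, for every $z \in \mathbb{R}^{n_z}$, the set $T^{\rm inv}(z)$ contains at most $p$ elements.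
   Context: A set-valued map $F : K \rightrightarrows \mathbb{R}^{n}$ associates to each $z \in K$ a subset $F(z) \subset \mathbb{R}^{n}$. The Hausdorff distance between two subsets $X_a, X_b$ of $\mathbb{R}^n$ is $d_{\mathcal H}(X_a,X_b) := \max\{\delta(X_a,X_b),\delta(X_b,X_a)\}$, where $\delta(X_a,X_b) := \sup_{x_a\in X_a}\inf_{x_b\in X_b}|x_a-x_b|$. A set-valued map $F: K \rightrightarrows \mathbb{R}^n$, $K \subset \mathbb{R}^m$, is Lipschitz if there exists $k>0$ such that $d_{\mathcal H}(F(z_a),F(z_b)) \le k|z_a-z_b|$ for all $z_a,z_b\in K$. *)

theory Defs
  imports "HOL-Analysis.Analysis"
begin

definition C1_map_on :: "(real^'n \<Rightarrow> real^'m) \<Rightarrow> (real^'n) set \<Rightarrow> bool" where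
  "C1_map_on f S \<longleftrightarrow>
     open S \<and> f differentiable_on S \<and> continuous_on S (\<lambda>x. jacobian f (at x))"

text \<open>
  The (directed) Hausdorff distance takes values in \<open>ennreal\<close>, so that the supremum over the
  empty set is \<open>0\<close>, the infimum over the empty set is \<open>\<infinity>\<close>, and unbounded sets may have
  infinite distance. In particular the distance between the empty set and a nonempty set
  is \<open>\<infinity>\<close>.
\<close>

definition hausdorff_excess :: "'a::metric_space set \<Rightarrow> 'a set \<Rightarrow> ennreal" where
  "hausdorff_excess A B = (SUP a\<in>A. INF b\<in>B. ennreal (dist a b))"

definition hausdorff_dist :: "'a::metric_space set \<Rightarrow> 'a set \<Rightarrow> ennreal" where
  "hausdorff_dist A B = max (hausdorff_excess A B) (hausdorff_excess B A)"

definition lipschitz_set_valued_on ::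
  "'a::metric_space set \<Rightarrow> ('a \<Rightarrow> 'b::metric_space set) \<Rightarrow> bool" where
  "lipschitz_set_valued_on K F \<longleftrightarrow>
     (\<exists>k::real. k > 0 \<and>
        (\<forall>a\<in>K. \<forall>b\<in>K. hausdorff_dist (F a) (F b) \<le> ennreal (k * dist a b)))"

definition preimage_map :: "('a \<Rightarrow> 'b) \<Rightarrow> 'a set \<Rightarrow> 'b \<Rightarrow> 'a set" where
  "preimage_map T X z = {x \<in> X. T x = z}"

end

theory Submission
  imports Defs
begin

text \<open>
  By compactness the immersion \<open>T\<close> has a Lipschitz inverse on every \<open>X \<inter> cball y d\<close>, with \<open>d\<close> and
  the constant independent of \<open>y\<close>, and the constant cardinality makes the fibres vary continuously.
  Let \<open>g y\<close> be the McShane extension of the inverse on \<open>X \<inter> cball y d\<close>. The infimum defining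
  \<open>g y w\<close> only sees points close to \<open>y\<close> when \<open>w\<close> is close to \<open>T y\<close>, so \<open>g y w = g y' w\<close> for
  neighbouring \<open>y\<close>, \<open>y'\<close>. Hence for \<open>w\<close> near \<open>T ` X\<close> the set of all \<open>g y w\<close> with \<open>T y\<close> near \<open>w\<close>
  is already obtained from one fibre and has at most \<open>p\<close> elements. Multiplying these sets by a
  Lipschitz cut-off function shrinks them to \<open>{0}\<close> away from \<open>T ` X\<close>.
\<close>

section \<open>Local inverses of immersions\<close>

lemma norm_matrix_vector_mult_le:
  fixes A :: "real^'n^'m"
  shows "norm (A *v v) \<le> real CARD('m) * real CARD('n) * norm A * norm v"
proof -
  have "\<bar>A $ i $ j\<bar> \<le> norm A" for i j
    by (rule order_trans[OF component_le_norm_cart Finite_Cartesian_Product.norm_nth_le])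
  then have "onorm ((*v) A) \<le> real CARD('m) * real CARD('n) * norm A"
    by (rule onorm_le_matrix_component)
  then show ?thesis
    by (meson matrix_vector_mul_bounded_linear mult_right_mono norm_ge_zero onorm order_trans)
qed

text \<open>The injective Jacobian at \<open>x\<close> stretches every vector by some factor
  \<open>B > 0\<close>. By continuity of the Jacobian, \<open>f\<close> differs from its
  linearization at \<open>x\<close> by a \<open>B / 2\<close>-Lipschitz map on a small ball, which
  leaves expansion by \<open>B / 2\<close>.\<close>

lemma C1_immersion_locally_expanding_at:
  fixes f :: "real^'n \<Rightarrow> real^'m"
  assumes "C1_map_on f U" "x \<in> U" "rank (jacobian f (at x)) = CARD('n)"
  obtains r c where "0 < r" "0 < c"
    "\<And>a b. a \<in> ball x r \<Longrightarrow> b \<in> ball x r \<Longrightarrow> c * dist a b \<le> dist (f a) (f b)"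
proof -
  let ?J = "\<lambda>y. jacobian f (at y)"
  have U: "open U" and diff: "f differentiable_on U" and cont: "continuous_on U ?J"
    using assms(1) by (auto simp: C1_map_on_def)
  have der: "(f has_derivative (\<lambda>h. ?J y *v h)) (at y)" if "y \<in> U" for y
    using diff that differentiable_on_eq_differentiable_at[OF U] iffD1[OF jacobian_works] by blast
  have "inj ((*v) (?J x))"
    using assms(3) by (simp add: full_rank_injective)
  then obtain B where B: "0 < B" "\<And>v. B * norm v \<le> norm (?J x *v v)"
    by (rule linear_inj_bounded_below_pos[OF matrix_vector_mul_linear]) (rule that)
  define N where "N = real CARD('m) * real CARD('n)"
  have N: "N > 0" by (simp add: N_def)
  \<comment> \<open>\<open>N\<close> is the crude factor between operator norm and matrix norm;
    \<open>e\<close> makes Jacobians \<open>e\<close>-close to \<open>?J x\<close> differ from it by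
    at most \<open>B / 2\<close> as operators.\<close>
  define e where "e = B / (2 * N)"
  have e: "e > 0" "N * e = B / 2" using B N by (auto simp: e_def)
  from cont U \<open>x \<in> U\<close> have "isCont ?J x" by (simp add: continuous_on_eq_continuous_at)
  then obtain s where s: "s > 0" "\<forall>y. dist y x < s \<longrightarrow> dist (?J y) (?J x) < e"
    using e(1) continuous_at_eps_delta[of x ?J] by blast
  from U \<open>x \<in> U\<close> obtain s' where s': "s' > 0" "ball x s' \<subseteq> U"
    by (rule openE)
  define r where "r = min s s'"
  have r: "r > 0" using s s' by (simp add: r_def)
  have "B / 2 * dist a b \<le> dist (f a) (f b)" if ab: "a \<in> ball x r" "b \<in> ball x r" for a b
  proof -
    have lin: "norm (f a - f b - (?J x *v (a - b))) \<le> norm (a - b) * (B / 2)"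
    proof (rule differentiable_bound_linearization[where S = "ball x r" and ?x0.0 = x and f' = "\<lambda>y h. ?J y *v h"])
      fix t :: real assume "t \<in> {0..1}"
      then have "(1 - t) *\<^sub>R b + t *\<^sub>R a \<in> ball x r"
        using convexD_alt[OF convex_ball ab(2,1), of t] by simp
      moreover have "(1 - t) *\<^sub>R b + t *\<^sub>R a = b + t *\<^sub>R (a - b)"
        by (simp add: algebra_simps)
      ultimately show "b + t *\<^sub>R (a - b) \<in> ball x r" by (simp only:)
    next
      fix y assume y: "y \<in> ball x r"
      show "(f has_derivative (\<lambda>h. ?J y *v h)) (at y within ball x r)"
        using y s'(2) by (intro has_derivative_at_withinI[OF der]) (auto simp: r_def)
      have le: "norm (?J y - ?J x) \<le> e"
        using spec[OF s(2), of y] y by (simp add: r_def dist_norm norm_minus_commute less_imp_le)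
      show "onorm ((\<lambda>h. ?J y *v h) - (\<lambda>h. ?J x *v h)) \<le> B / 2"
      proof (rule onorm_le)
        fix v
        have "norm ((?J y - ?J x) *v v) \<le> N * norm (?J y - ?J x) * norm v"
          unfolding N_def by (rule norm_matrix_vector_mult_le)
        also have "\<dots> \<le> N * e * norm v"
          using le N by (intro mult_right_mono mult_left_mono) auto
        finally show "norm (((\<lambda>h. ?J y *v h) - (\<lambda>h. ?J x *v h)) v) \<le> B / 2 * norm v"
          using e by (simp add: matrix_vector_mult_diff_rdistrib)
      qed
    next
      show "x \<in> ball x r" using r by simp
    qed
    have "B * norm (a - b) \<le> norm (?J x *v (a - b))" by (rule B)
    also have "\<dots> \<le> norm (f a - f b) + norm (f a - f b - (?J x *v (a - b)))"
      using norm_triangle_ineq4[of "f a - f b" "f a - f b - (?J x *v (a - b))"] by simp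
    finally show ?thesis using lin by (simp add: dist_norm field_simps)
  qed
  then show ?thesis using r B(1) by (intro that[of r "B / 2"]) auto
qed

text \<open>Keeping the centre \<open>z\<close> in the conclusion gives access to the constants
  attached to \<open>z\<close> on the whole ball around \<open>x\<close>.\<close>

lemma Lebesgue_number_balls:
  fixes S :: "'a::metric_space set"
  assumes "compact S" "S \<subseteq> (\<Union>z\<in>D. ball z (R z))"
  obtains e where "e > 0" "\<And>x. x \<in> S \<Longrightarrow> \<exists>z\<in>D. ball x e \<subseteq> ball z (R z)"
proof (rule Heine_Borel_lemma[OF assms])
  fix e assume e: "0 < e" "\<And>x. x \<in> S \<Longrightarrow> \<exists>G\<in>(\<lambda>z. ball z (R z)) ` D. ball x e \<subseteq> G"
  have "\<exists>z\<in>D. ball x e \<subseteq> ball z (R z)" if "x \<in> S" for x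
    using e(2)[OF that] by (simp only: bex_simps)
  with e(1) show thesis by (rule that)
qed auto

lemma uniformly_locally_expanding:
  fixes f :: "'a::metric_space \<Rightarrow> 'b::metric_space"
  assumes "compact X"
    and loc: "\<And>x. x \<in> X \<Longrightarrow> \<exists>r>0. \<exists>c>0. \<forall>a\<in>ball x r. \<forall>b\<in>ball x r.
                c * dist a b \<le> dist (f a) (f b)"
  obtains d k where "0 < d" "0 < k"
    "\<And>x y. x \<in> X \<Longrightarrow> y \<in> X \<Longrightarrow> dist x y \<le> d \<Longrightarrow> dist x y \<le> k * dist (f x) (f y)"
proof -
  obtain R C where RC: "\<And>x. x \<in> X \<Longrightarrow> R x > 0 \<and> C x > 0 \<and>
      (\<forall>a\<in>ball x (R x). \<forall>b\<in>ball x (R x). C x * dist a b \<le> dist (f a) (f b))"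
    using loc by metis
  have cover: "X \<subseteq> (\<Union>x\<in>X. ball x (R x))" using RC by fastforce
  obtain D where D: "D \<subseteq> X" "finite D" "X \<subseteq> (\<Union>x\<in>D. ball x (R x))"
    using compactE_image[OF assms(1) _ cover] by (metis open_ball)
  obtain e where e: "e > 0" "\<And>x. x \<in> X \<Longrightarrow> \<exists>z\<in>D. ball x e \<subseteq> ball z (R z)"
    by (rule Lebesgue_number_balls[OF assms(1) D(3)]) (rule that)
  \<comment> \<open>The sum dominates each of its finitely many terms; the summand 1 keeps
    \<open>k\<close> positive even for empty \<open>D\<close>.\<close>
  define k where "k = (\<Sum>x\<in>D. 1 / C x) + 1"
  have nonneg: "0 \<le> 1 / C x" if "x \<in> D" for x
    using RC[of x] that D(1) by (auto intro: less_imp_le)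
  have k: "k > 0" unfolding k_def using sum_nonneg[of D "\<lambda>x. 1 / C x"] nonneg by fastforce
  have le_k: "1 / C x \<le> k" if "x \<in> D" for x
    using member_le_sum[OF that, of "\<lambda>x. 1 / C x"] nonneg D(2) unfolding k_def by auto
  have "dist x y \<le> k * dist (f x) (f y)" if xy: "x \<in> X" "y \<in> X" "dist x y \<le> e / 2" for x y
  proof -
    obtain z where z: "z \<in> D" "ball x e \<subseteq> ball z (R z)" using e(2)[OF xy(1)] by blast
    have "x \<in> ball z (R z)" "y \<in> ball z (R z)" using z(2) xy(3) e(1) by (auto simp: subset_iff)
    then have "C z * dist x y \<le> dist (f x) (f y)" and "C z > 0" using RC z(1) D(1) by blast+
    then have "dist x y \<le> 1 / C z * dist (f x) (f y)" by (simp add: field_simps)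
    also have "\<dots> \<le> k * dist (f x) (f y)" using le_k[OF z(1)] by (intro mult_right_mono) auto
    finally show ?thesis .
  qed
  then show ?thesis using e(1) k by (intro that[of "e / 2" k]) auto
qed

section \<open>Continuity of the fibres\<close>

text \<open>The points of \<open>X\<close> at distance at least \<open>e\<close> from the fibre form
  a compact set. Its image is closed and misses \<open>z\<close>, hence misses a ball around
  \<open>z\<close>.\<close>

lemma fibre_upper_semicontinuous:
  fixes f :: "'a::metric_space \<Rightarrow> 'b::metric_space"
  assumes "compact X" "continuous_on X f" "e > 0"
  obtains r where "r > 0"
    "\<And>y. y \<in> X \<Longrightarrow> dist (f y) z < r \<Longrightarrow> \<exists>x\<in>preimage_map f X z. dist y x < e"
proof -
  let ?Y = "X - (\<Union>x\<in>preimage_map f X z. ball x e)"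
  have "compact ?Y" using assms(1) by (intro compact_diff) auto
  then have "compact (f ` ?Y)"
    using assms(2) by (meson Diff_subset compact_continuous_image continuous_on_subset)
  moreover have "z \<notin> f ` ?Y"
    using \<open>e > 0\<close> by (force simp: preimage_map_def)
  ultimately have "open (- f ` ?Y)" "z \<in> - f ` ?Y"
    by (auto dest: compact_imp_closed)
  then obtain r where r: "r > 0" "ball z r \<subseteq> - f ` ?Y"
    by (rule openE)
  have "\<exists>x\<in>preimage_map f X z. dist y x < e" if y: "y \<in> X" "dist (f y) z < r" for y
  proof (rule ccontr)
    assume "\<not> ?thesis"
    then have "y \<in> ?Y" using y(1) by (auto simp: dist_commute)
    then have "f y \<notin> ball z r" using r(2) by blast
    with y(2) show False by (simp add: dist_commute)
  qed
  with r(1) show ?thesis by (rule that)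
qed

text \<open>A counting argument: sending each point of a nearby fibre to a close point of the fibre
  over \<open>z\<close> is injective, because distinct points of a fibre are more than
  \<open>d\<close> apart. Both fibres have \<open>p\<close> points, so the map is onto and every
  point over \<open>z\<close> is approached.\<close>

lemma fibre_lower_semicontinuous:
  fixes f :: "'a::metric_space \<Rightarrow> 'b::metric_space"
  assumes "compact X" "continuous_on X f" "e > 0" "d > 0"
    and inj: "\<And>x y. x \<in> X \<Longrightarrow> y \<in> X \<Longrightarrow> dist x y \<le> d \<Longrightarrow> f x = f y \<Longrightarrow> x = y"
    and "p \<ge> 1" and card: "\<And>z. z \<in> f ` X \<Longrightarrow> card (preimage_map f X z) = p"
    and "z \<in> f ` X"
  obtains r where "r > 0"
    "\<And>z' x. z' \<in> f ` X \<Longrightarrow> dist z' z < r \<Longrightarrow> x \<in> preimage_map f X z \<Longrightarrow>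
       \<exists>y\<in>preimage_map f X z'. dist x y < e"
proof -
  \<comment> \<open>The bound \<open>d / 2\<close> puts two points with the same partner within
    \<open>d\<close> of each other, where \<open>inj\<close> applies.\<close>
  obtain r where r: "r > 0"
    "\<And>y. y \<in> X \<Longrightarrow> dist (f y) z < r \<Longrightarrow> \<exists>x\<in>preimage_map f X z. dist y x < min e (d / 2)"
    using fibre_upper_semicontinuous[OF assms(1,2), of "min e (d / 2)" z] assms(3,4) by auto
  have "\<exists>y\<in>preimage_map f X z'. dist x y < e"
    if z': "z' \<in> f ` X" "dist z' z < r" and x: "x \<in> preimage_map f X z" for z' x
  proof -
    have "\<forall>y\<in>preimage_map f X z'. \<exists>x\<in>preimage_map f X z. dist y x < min e (d / 2)"
      using r(2) z' by (auto simp: preimage_map_def)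
    then obtain h where h: "\<And>y. y \<in> preimage_map f X z' \<Longrightarrow>
        h y \<in> preimage_map f X z \<and> dist y (h y) < min e (d / 2)"
      by metis
    have "inj_on h (preimage_map f X z')"
    proof (rule inj_onI)
      fix a b assume ab: "a \<in> preimage_map f X z'" "b \<in> preimage_map f X z'" "h a = h b"
      then have "dist a b \<le> d"
        using h[OF ab(1)] h[OF ab(2)] dist_triangle2[of a b "h a"] by auto
      with ab show "a = b" by (intro inj) (auto simp: preimage_map_def)
    qed
    \<comment> \<open>Infinite sets have \<open>card\<close> 0, which \<open>p \<ge> 1\<close> rules
      out.\<close>
    moreover have "finite (preimage_map f X z)" "finite (preimage_map f X z')"
      using card[OF z'(1)] card[OF \<open>z \<in> f ` X\<close>] \<open>p \<ge> 1\<close> by (auto intro: card_ge_0_finite)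
    ultimately have "h ` preimage_map f X z' = preimage_map f X z"
      using h card[OF z'(1)] card[OF \<open>z \<in> f ` X\<close>] by (intro card_subset_eq) (auto simp: card_image)
    with x obtain y where "y \<in> preimage_map f X z'" "x = h y" by auto
    with h[OF this(1)] show ?thesis by (auto simp: dist_commute)
  qed
  with r(1) show ?thesis by (rule that)
qed

lemma fibre_uniformly_continuous:
  fixes f :: "'a::metric_space \<Rightarrow> 'b::metric_space"
  assumes "compact X" "continuous_on X f" "e > 0" "d > 0"
    and inj: "\<And>x y. x \<in> X \<Longrightarrow> y \<in> X \<Longrightarrow> dist x y \<le> d \<Longrightarrow> f x = f y \<Longrightarrow> x = y"
    and "p \<ge> 1" and card: "\<And>z. z \<in> f ` X \<Longrightarrow> card (preimage_map f X z) = p"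
  obtains r where "r > 0"
    "\<And>x z. x \<in> X \<Longrightarrow> z \<in> f ` X \<Longrightarrow> dist (f x) z < r \<Longrightarrow>
       \<exists>y\<in>preimage_map f X z. dist x y < e"
proof -
  have "\<exists>r>0. (\<forall>y\<in>X. dist (f y) z < r \<longrightarrow> (\<exists>x\<in>preimage_map f X z. dist y x < e / 2)) \<and>
      (\<forall>z'\<in>f ` X. dist z' z < r \<longrightarrow>
        (\<forall>x\<in>preimage_map f X z. \<exists>y\<in>preimage_map f X z'. dist x y < e / 2))"
    if z: "z \<in> f ` X" for z
  proof -
    obtain r1 where r1: "r1 > 0"
      "\<And>y. y \<in> X \<Longrightarrow> dist (f y) z < r1 \<Longrightarrow> \<exists>x\<in>preimage_map f X z. dist y x < e / 2"
      using fibre_upper_semicontinuous[OF assms(1,2), of "e / 2" z] \<open>e > 0\<close> by auto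
    obtain r2 where r2: "r2 > 0"
      "\<And>z' x. z' \<in> f ` X \<Longrightarrow> dist z' z < r2 \<Longrightarrow> x \<in> preimage_map f X z \<Longrightarrow>
       \<exists>y\<in>preimage_map f X z'. dist x y < e / 2"
      using fibre_lower_semicontinuous[OF assms(1,2) half_gt_zero[OF \<open>e > 0\<close>] \<open>d > 0\<close> inj \<open>p \<ge> 1\<close> card z]
      by blast
    show ?thesis using r1 r2 by (intro exI[of _ "min r1 r2"]) simp
  qed
  then obtain R where R: "\<And>z. z \<in> f ` X \<Longrightarrow> R z > 0"
    "\<And>z y. z \<in> f ` X \<Longrightarrow> y \<in> X \<Longrightarrow> dist (f y) z < R z \<Longrightarrow>
       \<exists>x\<in>preimage_map f X z. dist y x < e / 2"
    "\<And>z z' x. z \<in> f ` X \<Longrightarrow> z' \<in> f ` X \<Longrightarrow> dist z' z < R z \<Longrightarrow> x \<in> preimage_map f X z \<Longrightarrow>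
       \<exists>y\<in>preimage_map f X z'. dist x y < e / 2"
    by metis
  have "compact (f ` X)" using assms(1,2) compact_continuous_image by blast
  moreover have "f ` X \<subseteq> (\<Union>z\<in>f ` X. ball z (R z))" using R(1) by fastforce
  ultimately obtain r where r: "r > 0"
    "\<And>z. z \<in> f ` X \<Longrightarrow> \<exists>z0\<in>f ` X. ball z r \<subseteq> ball z0 (R z0)"
    by (rule Lebesgue_number_balls) (rule that)
  have "\<exists>y\<in>preimage_map f X z. dist x y < e"
    if xz: "x \<in> X" "z \<in> f ` X" "dist (f x) z < r" for x z
  proof -
    \<comment> \<open>Both fibres are compared with the one over \<open>z0\<close>: upper
      semicontinuity leads from \<open>x\<close> to \<open>x0\<close>, lower semicontinuity from
      \<open>x0\<close> to \<open>y\<close>.\<close>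
    obtain z0 where z0: "z0 \<in> f ` X" "ball z r \<subseteq> ball z0 (R z0)" using r(2)[OF xz(2)] by blast
    have near: "dist (f x) z0 < R z0" "dist z z0 < R z0"
      using subsetD[OF z0(2), of "f x"] subsetD[OF z0(2), of z] xz(3) r(1) by (auto simp: dist_commute)
    obtain x0 where x0: "x0 \<in> preimage_map f X z0" "dist x x0 < e / 2"
      using R(2)[OF z0(1) xz(1) near(1)] by auto
    obtain y where "y \<in> preimage_map f X z" "dist x0 y < e / 2"
      using R(3)[OF z0(1) xz(2) near(2) x0(1)] by auto
    then show ?thesis using x0(2) dist_triangle[of x y x0] by (intro bexI[of _ y]) auto
  qed
  with r(1) show ?thesis by (rule that)
qed

section \<open>McShane extension of a partial inverse\<close>

text \<open>If \<open>f\<close> is injective on \<open>S\<close> and its inverse is \<open>K\<close>-Lipschitz there, this is the coordinatewise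
  McShane extension of that inverse from \<open>f ` S\<close> to the whole space.\<close>

definition mcshane_inverse ::
  "('a::euclidean_space \<Rightarrow> 'b::metric_space) \<Rightarrow> real \<Rightarrow> 'a set \<Rightarrow> 'b \<Rightarrow> 'a" where
  "mcshane_inverse f K S w = (\<Sum>i\<in>Basis. (INF x\<in>S. x \<bullet> i + K * dist w (f x)) *\<^sub>R i)"

lemma mcshane_inverse_inner:
  "i \<in> Basis \<Longrightarrow> mcshane_inverse f K S w \<bullet> i = (INF x\<in>S. x \<bullet> i + K * dist w (f x))"
  by (simp add: mcshane_inverse_def)

lemma bdd_below_mcshane:
  fixes S :: "'a::euclidean_space set"
  assumes "bounded S" "i \<in> Basis" "K \<ge> 0"
  shows "bdd_below ((\<lambda>x. x \<bullet> i + K * dist w (f x)) ` S)"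
proof -
  obtain B where B: "\<And>x. x \<in> S \<Longrightarrow> norm x \<le> B" using assms(1) by (auto simp: bounded_iff)
  have "- B \<le> x \<bullet> i + K * dist w (f x)" if "x \<in> S" for x
    using B[OF that] Basis_le_norm[OF assms(2), of x] mult_nonneg_nonneg[OF \<open>K \<ge> 0\<close> zero_le_dist[of w "f x"]]
    by linarith
  then show ?thesis by (rule bdd_belowI2)
qed

text \<open>Each coordinate is an infimum of \<open>K\<close>-Lipschitz functions, hence
  \<open>K\<close>-Lipschitz; bounding the norm by the sum of the coordinates costs the
  dimension.\<close>

lemma dist_mcshane_inverse_le:
  fixes S :: "'a::euclidean_space set"
  assumes "bounded S" "S \<noteq> {}" "K \<ge> 0"
  shows "dist (mcshane_inverse f K S w) (mcshane_inverse f K S w') \<le> real DIM('a) * K * dist w w'"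
proof -
  let ?h = "\<lambda>w x i. x \<bullet> i + K * dist w (f x)"
  have le: "(INF x\<in>S. ?h w x i) \<le> (INF x\<in>S. ?h w' x i) + K * dist w w'" if i: "i \<in> Basis" for w w' i
  proof -
    have "(INF x\<in>S. ?h w x i) - K * dist w w' \<le> ?h w' x i" if "x \<in> S" for x
    proof -
      have "(INF x\<in>S. ?h w x i) \<le> ?h w x i"
        by (rule cINF_lower[OF bdd_below_mcshane[OF assms(1) i assms(3)] that])
      also have "\<dots> \<le> x \<bullet> i + K * (dist w w' + dist w' (f x))"
        using assms(3) dist_triangle[of w "f x" w'] by (intro add_left_mono mult_left_mono) auto
      finally show ?thesis by (simp add: algebra_simps)
    qed
    then have "(INF x\<in>S. ?h w x i) - K * dist w w' \<le> (INF x\<in>S. ?h w' x i)"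
      by (rule cINF_greatest[OF assms(2)])
    then show ?thesis by linarith
  qed
  have "norm (mcshane_inverse f K S w - mcshane_inverse f K S w') \<le>
      (\<Sum>i\<in>(Basis :: 'a set). \<bar>(mcshane_inverse f K S w - mcshane_inverse f K S w') \<bullet> i\<bar>)"
    by (rule norm_le_l1)
  also have "\<dots> \<le> (\<Sum>i\<in>(Basis :: 'a set). K * dist w w')"
  proof (rule sum_mono)
    fix i :: 'a assume i: "i \<in> Basis"
    then show "\<bar>(mcshane_inverse f K S w - mcshane_inverse f K S w') \<bullet> i\<bar> \<le> K * dist w w'"
      using le[OF i, of w w'] le[OF i, of w' w]
      by (simp add: inner_diff_left mcshane_inverse_inner dist_commute abs_le_iff)
  qed
  finally show ?thesis by (simp add: dist_norm mult.assoc)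
qed

text \<open>At \<open>f x\<close> the competitor \<open>x\<close> carries no penalty, and
  \<open>lip\<close> says that the penalty of any other point outweighs what it gains in a
  coordinate.\<close>

lemma mcshane_inverse_eq:
  assumes S: "bounded S" "K \<ge> 0" "x \<in> S" and lip: "\<And>y. y \<in> S \<Longrightarrow> dist x y \<le> K * dist (f x) (f y)"
  shows "mcshane_inverse f K S (f x) = x"
proof (rule euclidean_eqI)
  fix i :: 'a assume i: "i \<in> Basis"
  have "(INF y\<in>S. y \<bullet> i + K * dist (f x) (f y)) = x \<bullet> i"
  proof (rule antisym)
    show "(INF y\<in>S. y \<bullet> i + K * dist (f x) (f y)) \<le> x \<bullet> i"
      using cINF_lower[OF bdd_below_mcshane[OF S(1) i S(2), of "f x" f] S(3)] by simp
    show "x \<bullet> i \<le> (INF y\<in>S. y \<bullet> i + K * dist (f x) (f y))"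
    proof (rule cINF_greatest)
      fix y assume "y \<in> S"
      have "x \<bullet> i - y \<bullet> i \<le> dist x y"
        using Basis_le_norm[OF i, of "x - y"] by (simp add: inner_diff_left dist_norm)
      then show "x \<bullet> i \<le> y \<bullet> i + K * dist (f x) (f y)" using lip[OF \<open>y \<in> S\<close>] by simp
    qed (use S(3) in auto)
  qed
  with i show "mcshane_inverse f K S (f x) \<bullet> i = x \<bullet> i" by (simp add: mcshane_inverse_inner)
qed

text \<open>The penalty is nonnegative, so coordinates are at least \<open>- B\<close>; the
  competitor \<open>y\<close> bounds them from above.\<close>

lemma norm_mcshane_inverse_le:
  fixes S :: "'a::euclidean_space set" and B K r :: real
  assumes B: "\<And>x. x \<in> S \<Longrightarrow> norm x \<le> B" and "K \<ge> 0" "y \<in> S" "dist w (f y) \<le> r"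
  shows "norm (mcshane_inverse f K S w) \<le> real DIM('a) * (B + K * r)"
proof -
  have S: "bounded S" using B by (auto simp: bounded_iff)
  have Kr: "K * dist w (f y) \<le> K * r" "0 \<le> K * dist w (f y)"
    using assms by (auto intro: mult_left_mono)
  have "norm (mcshane_inverse f K S w) \<le> (\<Sum>i\<in>(Basis :: 'a set). \<bar>mcshane_inverse f K S w \<bullet> i\<bar>)"
    by (rule norm_le_l1)
  also have "\<dots> \<le> (\<Sum>i\<in>(Basis :: 'a set). B + K * r)"
  proof (rule sum_mono)
    fix i :: 'a assume i: "i \<in> Basis"
    have comp: "\<bar>x \<bullet> i\<bar> \<le> B" if "x \<in> S" for x
      using Basis_le_norm[OF i, of x] B[OF that] by simp
    have "(INF x\<in>S. x \<bullet> i + K * dist w (f x)) \<le> y \<bullet> i + K * dist w (f y)"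
      by (rule cINF_lower[OF bdd_below_mcshane[OF S i \<open>K \<ge> 0\<close>] \<open>y \<in> S\<close>])
    moreover have "- B \<le> (INF x\<in>S. x \<bullet> i + K * dist w (f x))"
    proof (rule cINF_greatest)
      fix x assume "x \<in> S"
      then show "- B \<le> x \<bullet> i + K * dist w (f x)"
        using comp[of x] mult_nonneg_nonneg[OF \<open>K \<ge> 0\<close> zero_le_dist[of w "f x"]] by linarith
    qed (use \<open>y \<in> S\<close> in auto)
    ultimately show "\<bar>mcshane_inverse f K S w \<bullet> i\<bar> \<le> B + K * r"
      using comp[OF \<open>y \<in> S\<close>] Kr i by (simp add: mcshane_inverse_inner)
  qed
  finally show ?thesis by simp
qed

text \<open>Locality: near \<open>f y\<close> the infimum defining the extension over \<open>X \<inter> cball y d\<close> is determined by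
  the points close to \<open>y\<close>, so the extensions over overlapping balls agree there.\<close>

lemma mcshane_inverse_local_le:
  fixes X :: "'a::euclidean_space set"
  assumes "bounded X" "k > 0" "4 * (2 * k) * r \<le> d" "i \<in> Basis"
    and lip: "\<And>x y. x \<in> X \<Longrightarrow> y \<in> X \<Longrightarrow> dist x y \<le> d \<Longrightarrow> dist x y \<le> k * dist (f x) (f y)"
    and y: "y \<in> X" "y' \<in> X" "dist y y' \<le> d / 2" "dist w (f y) < r"
  shows "mcshane_inverse f (2 * k) (X \<inter> cball y' d) w \<bullet> i
       \<le> mcshane_inverse f (2 * k) (X \<inter> cball y d) w \<bullet> i"
  unfolding mcshane_inverse_inner[OF \<open>i \<in> Basis\<close>]
proof (rule cINF_mono)
  have "d \<ge> 0" using y(3) zero_le_dist[of y y'] by linarith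
  show "X \<inter> cball y d \<noteq> {}" using y(1) \<open>d \<ge> 0\<close> by fastforce
  show "bdd_below ((\<lambda>x. x \<bullet> i + 2 * k * dist w (f x)) ` (X \<inter> cball y' d))"
    using assms(1,2,4) by (intro bdd_below_mcshane) (auto intro: bounded_Int)
  fix x assume x: "x \<in> X \<inter> cball y d"
  \<comment> \<open>A competitor \<open>x\<close> within \<open>d / 2\<close> of \<open>y\<close>
    also lies in the other ball. Any other one is beaten by \<open>y\<close> itself.\<close>
  show "\<exists>x'\<in>X \<inter> cball y' d. x' \<bullet> i + 2 * k * dist w (f x') \<le> x \<bullet> i + 2 * k * dist w (f x)"
  proof (cases "dist y x \<le> d / 2")
    case True
    then have "dist y' x \<le> d" using y(3) dist_triangle[of y' x y] by (simp add: dist_commute)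
    with x show ?thesis by (intro bexI[of _ x]) auto
  next
    case False
    have "dist y x \<le> k * dist (f y) (f x)" by (rule lip) (use x y(1) in auto)
    also have "\<dots> \<le> k * (dist w (f y) + dist w (f x))"
      using \<open>k > 0\<close> dist_triangle3[of "f y" "f x" w] by (intro mult_left_mono) auto
    \<comment> \<open>Here the doubled constant pays off: \<open>x\<close> gains at most
      \<open>dist y x\<close> in the coordinate, and the surplus \<open>dist y x > d / 2\<close>
      covers twice the penalty of \<open>y\<close>, which is at most
      \<open>4 * k * r\<close>.\<close>
    finally have "2 * dist y x \<le> 2 * k * dist w (f y) + 2 * k * dist w (f x)"
      by (simp add: algebra_simps)
    moreover have "y \<bullet> i - x \<bullet> i \<le> dist y x"
      using Basis_le_norm[OF \<open>i \<in> Basis\<close>, of "y - x"] by (simp add: inner_diff_left dist_norm)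
    moreover have "2 * k * dist w (f y) \<le> 2 * k * r"
      using y(4) \<open>k > 0\<close> by (intro mult_left_mono) auto
    ultimately have "y \<bullet> i + 2 * k * dist w (f y) \<le> x \<bullet> i + 2 * k * dist w (f x)"
      using False assms(3) by linarith
    moreover have "y \<in> X \<inter> cball y' d" using y(1,3) \<open>d \<ge> 0\<close> by (simp add: dist_commute)
    ultimately show ?thesis by blast
  qed
qed

lemma mcshane_inverse_local:
  fixes X :: "'a::euclidean_space set"
  assumes "bounded X" "k > 0" "4 * (2 * k) * r \<le> d"
    and "\<And>x y. x \<in> X \<Longrightarrow> y \<in> X \<Longrightarrow> dist x y \<le> d \<Longrightarrow> dist x y \<le> k * dist (f x) (f y)"
    and "y \<in> X" "y' \<in> X" "dist y y' \<le> d / 2" "dist w (f y) < r" "dist w (f y') < r"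
  shows "mcshane_inverse f (2 * k) (X \<inter> cball y d) w = mcshane_inverse f (2 * k) (X \<inter> cball y' d) w"
proof (rule euclidean_eqI, rule antisym)
  fix i :: 'a assume i: "i \<in> Basis"
  show "mcshane_inverse f (2 * k) (X \<inter> cball y d) w \<bullet> i
      \<le> mcshane_inverse f (2 * k) (X \<inter> cball y' d) w \<bullet> i"
    by (rule mcshane_inverse_local_le[OF assms(1-3) i assms(4)])
      (use assms(5-9) in \<open>simp_all add: dist_commute\<close>)
  show "mcshane_inverse f (2 * k) (X \<inter> cball y' d) w \<bullet> i
      \<le> mcshane_inverse f (2 * k) (X \<inter> cball y d) w \<bullet> i"
    by (rule mcshane_inverse_local_le[OF assms(1-3) i assms(4)])
      (use assms(5-9) in simp_all)
qed

section \<open>The set-valued extension\<close>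

lemma hausdorff_excess_le:
  assumes "\<And>a. a \<in> A \<Longrightarrow> \<exists>b\<in>B. dist a b \<le> c"
  shows "hausdorff_excess A B \<le> ennreal c"
  unfolding hausdorff_excess_def
proof (rule SUP_least)
  fix a assume "a \<in> A"
  then obtain b where "b \<in> B" "dist a b \<le> c" using assms by blast
  then show "(INF b\<in>B. ennreal (dist a b)) \<le> ennreal c"
    by (intro INF_lower2[of b]) (auto intro: ennreal_leI)
qed

lemma lipschitz_set_valuedI:
  assumes "k > 0"
    and "\<And>a b u. a \<in> K \<Longrightarrow> b \<in> K \<Longrightarrow> u \<in> F a \<Longrightarrow> \<exists>v\<in>F b. dist u v \<le> k * dist a b"
  shows "lipschitz_set_valued_on K F"
  unfolding lipschitz_set_valued_on_def
proof (intro exI[of _ k] conjI ballI)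
  fix a b assume "a \<in> K" "b \<in> K"
  then show "hausdorff_dist (F a) (F b) \<le> ennreal (k * dist a b)"
    unfolding hausdorff_dist_def
    using assms(2)[of a b] assms(2)[of b a]
    by (intro max.boundedI hausdorff_excess_le) (auto simp: dist_commute)
qed (rule assms(1))

lemma infdist_lessE:
  assumes "infdist w A < r" "A \<noteq> {}"
  obtains a where "a \<in> A" "dist w a < r"
  using assms by (auto simp: infdist_def cINF_less_iff)

text \<open>Scaling by the cut-off collapses the values to \<open>{0}\<close> from distance
  \<open>r\<close> on without adding elements. The margin up to \<open>2 * r\<close> ensures that of
  two points less than \<open>r\<close> apart, either both have value \<open>{0}\<close> or both lie
  where \<open>G\<close> is controlled.\<close>

lemma lipschitz_set_valued_cutoff:
  fixes G :: "'b::metric_space \<Rightarrow> 'a::real_normed_vector set"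
  assumes "r > 0" "L > 0" "B > 0"
    and ne: "\<And>w. infdist w Z < 2 * r \<Longrightarrow> G w \<noteq> {}"
    and B: "\<And>w u. infdist w Z < 2 * r \<Longrightarrow> u \<in> G w \<Longrightarrow> norm u \<le> B"
    and L: "\<And>a b u. infdist a Z < 2 * r \<Longrightarrow> infdist b Z < 2 * r \<Longrightarrow> dist a b < r \<Longrightarrow> u \<in> G a \<Longrightarrow>
              \<exists>v\<in>G b. dist u v \<le> L * dist a b"
  shows "lipschitz_set_valued_on UNIV
    (\<lambda>w. if infdist w Z < 2 * r then (*\<^sub>R) (max 0 (1 - infdist w Z / r)) ` G w else {0})"
    (is "lipschitz_set_valued_on _ ?F")
proof -
  define \<phi> where "\<phi> w = max 0 (1 - infdist w Z / r)" for w
  have \<phi>: "0 \<le> \<phi> w" "\<phi> w \<le> 1" for w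
    using \<open>r > 0\<close> by (auto simp: \<phi>_def infdist_nonneg)
  have F: "?F = (\<lambda>w. if infdist w Z < 2 * r then (*\<^sub>R) (\<phi> w) ` G w else {0})"
    unfolding \<phi>_def by (rule refl)
  have \<phi>0: "\<phi> w = 0" if "infdist w Z \<ge> r" for w
    using that \<open>r > 0\<close> by (simp add: \<phi>_def)
  have \<phi>_lip: "\<bar>\<phi> a - \<phi> b\<bar> \<le> dist a b / r" for a b
  proof -
    have "\<bar>infdist a Z / r - infdist b Z / r\<bar> \<le> dist a b / r"
      using infdist_triangle_abs[of a Z b] \<open>r > 0\<close>
      by (simp flip: diff_divide_distrib add: divide_right_mono)
    then show ?thesis unfolding \<phi>_def by linarith
  qed
  have ne': "?F w \<noteq> {}" for w using ne by auto
  have B': "norm u \<le> B" if "u \<in> ?F w" for u w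
  proof (cases "infdist w Z < 2 * r")
    case True
    with that obtain g where g: "g \<in> G w" "u = \<phi> w *\<^sub>R g" by (auto simp: \<phi>_def)
    have "norm u \<le> 1 * B"
      unfolding g(2) norm_scaleR using \<phi>[of w] B[OF True g(1)] by (intro mult_mono) auto
    then show ?thesis by simp
  qed (use that \<open>B > 0\<close> in auto)
  have zero: "u = 0" if "infdist w Z \<ge> r" "u \<in> ?F w" for u w
    using that \<phi>0[OF that(1)] by (auto simp: F split: if_splits)
  \<comment> \<open>\<open>L\<close> accounts for the variation of \<open>G\<close> and
    \<open>B / r\<close> for that of the cut-off; \<open>2 * B / r\<close> is what pairs at distance
    at least \<open>r\<close> require, their values being bounded by \<open>B\<close>.\<close>
  define k where "k = L + 2 * B / r"
  have k: "k > 0" using assms by (simp add: k_def add_pos_pos)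
  have "\<exists>v\<in>?F b. dist u v \<le> k * dist a b" if u: "u \<in> ?F a" for a b u
  proof (cases "dist a b < r")
    case False
    obtain v where v: "v \<in> ?F b" using ne' by blast
    have "dist u v \<le> 2 * B" using B'[OF u] B'[OF v] norm_triangle_ineq4[of u v] by (simp add: dist_norm)
    also have "\<dots> \<le> 2 * B / r * dist a b" using False assms by (simp add: field_simps)
    also have "\<dots> \<le> k * dist a b" using assms by (intro mult_right_mono) (auto simp: k_def)
    finally show ?thesis using v by blast
  next
    case near: True
    have tri: "infdist a Z \<le> infdist b Z + dist a b" "infdist b Z \<le> infdist a Z + dist a b"
      using infdist_triangle[of a Z b] infdist_triangle[of b Z a] by (auto simp: dist_commute)
    show ?thesis
    proof (cases "infdist a Z \<ge> r \<and> infdist b Z \<ge> r")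
      case True
      obtain v where v: "v \<in> ?F b" using ne' by blast
      have "u = 0" "v = 0" using zero u v True by blast+
      then show ?thesis using v k by (intro bexI[of _ v]) auto
    next
      case False
      then have ab: "infdist a Z < 2 * r" "infdist b Z < 2 * r" using tri near by auto
      from u ab obtain g where g: "g \<in> G a" "u = \<phi> a *\<^sub>R g" by (auto simp: \<phi>_def)
      obtain h where h: "h \<in> G b" "dist g h \<le> L * dist a b" using L[OF ab near g(1)] by blast
      \<comment> \<open>The product-rule splitting separates the variation of \<open>G\<close> from
        that of the cut-off.\<close>
      have "dist u (\<phi> b *\<^sub>R h) = norm (\<phi> a *\<^sub>R (g - h) + (\<phi> a - \<phi> b) *\<^sub>R h)"
        by (simp add: g dist_norm algebra_simps)
      also have "\<dots> \<le> norm (\<phi> a *\<^sub>R (g - h)) + norm ((\<phi> a - \<phi> b) *\<^sub>R h)"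
        by (rule norm_triangle_ineq)
      also have "\<dots> \<le> 1 * (L * dist a b) + dist a b / r * B"
        unfolding norm_scaleR using \<phi>[of a] \<phi>_lip[of a b] h(2) B[OF ab(2) h(1)] \<open>r > 0\<close>
        by (intro add_mono mult_mono) (auto simp: dist_norm)
      also have "\<dots> \<le> k * dist a b" using assms by (simp add: k_def field_simps)
      finally show ?thesis using h(1) ab by (intro bexI[of _ "\<phi> b *\<^sub>R h"]) (auto simp: \<phi>_def)
    qed
  qed
  with k show ?thesis by (intro lipschitz_set_valuedI[of k]) blast+
qed

text \<open>Differentiability now enters only through the uniform bound \<open>lip\<close>.
  Nonemptiness of \<open>X\<close> matters because \<open>infdist\<close> to the empty set is 0 by
  convention.\<close>

lemma lipschitz_extension_of_fibres:
  fixes f :: "'a::euclidean_space \<Rightarrow> 'b::metric_space"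
  assumes X: "compact X" "X \<noteq> {}" and f: "continuous_on X f" and dk: "d > 0" "k > 0"
    and lip: "\<And>x y. x \<in> X \<Longrightarrow> y \<in> X \<Longrightarrow> dist x y \<le> d \<Longrightarrow> dist x y \<le> k * dist (f x) (f y)"
    and p: "p \<ge> 1" and card: "\<And>z. z \<in> f ` X \<Longrightarrow> card (preimage_map f X z) = p"
  shows "\<exists>F. lipschitz_set_valued_on UNIV F \<and> (\<forall>z\<in>f ` X. F z = preimage_map f X z) \<and>
           (\<forall>z. finite (F z) \<and> card (F z) \<le> p)"
proof -
  have inj: "x = y" if "x \<in> X" "y \<in> X" "dist x y \<le> d" "f x = f y" for x y
    using lip[OF that(1-3)] that(4) by simp
  obtain r0 where r0: "r0 > 0" "\<And>x z. x \<in> X \<Longrightarrow> z \<in> f ` X \<Longrightarrow> dist (f x) z < r0 \<Longrightarrow>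
       \<exists>y\<in>preimage_map f X z. dist x y < d / 2"
    using fibre_uniformly_continuous[OF X(1) f half_gt_zero[OF dk(1)] dk(1) inj p card] by blast
  \<comment> \<open>With \<open>r0 / 2\<close>, image points within \<open>r\<close> of a common
    \<open>w\<close> are less than \<open>r0\<close> apart, so their fibres are close;
    \<open>d / (8 * k)\<close> is the locality condition for the constant
    \<open>2 * k\<close>.\<close>
  define r where "r = min (r0 / 2) (d / (8 * k))"
  have r: "r > 0" "2 * r \<le> r0" using r0(1) dk by (auto simp: r_def)
  have "r \<le> d / (8 * k)" by (simp add: r_def)
  with dk have rd: "4 * (2 * k) * r \<le> d" by (simp add: field_simps)
  define g where "g y w = mcshane_inverse f (2 * k) (X \<inter> cball y d) w" for y w
  define G where "G w = (\<lambda>y. g y w) ` {y \<in> X. dist w (f y) < r}" for w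
  note bdd = compact_imp_bounded[OF X(1)]
  \<comment> \<open>Continuity of the fibres supplies a point \<open>y\<close> over
    \<open>f y0\<close> close to \<open>x\<close>; locality then identifies the two
    extensions.\<close>
  have transfer: "\<exists>y\<in>X. f y = f y0 \<and> (\<forall>w'. dist w' (f x) < r \<longrightarrow> dist w' (f y) < r \<longrightarrow> g x w' = g y w')"
    if xy: "x \<in> X" "y0 \<in> X" "dist w (f x) < r" "dist w (f y0) < r" for x y0 w
  proof -
    have "dist (f x) (f y0) < r0"
      using xy(3,4) r(2) dist_triangle3[of "f x" "f y0" w] by linarith
    then obtain y where y: "y \<in> X" "f y = f y0" "dist x y < d / 2"
      using r0(2)[of x "f y0"] xy(1,2) by (auto simp: preimage_map_def)
    have "g x w' = g y w'" if "dist w' (f x) < r" "dist w' (f y) < r" for w'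
      unfolding g_def
      using mcshane_inverse_local[OF bdd dk(2) rd lip \<open>x \<in> X\<close> y(1) less_imp_le[OF y(3)] that] by blast
    with y show ?thesis by blast
  qed
  have g_f: "g y (f y) = y" if "y \<in> X" for y
    unfolding g_def
  proof (rule mcshane_inverse_eq)
    fix x assume x: "x \<in> X \<inter> cball y d"
    have "dist y x \<le> k * dist (f y) (f x)" using lip x that by auto
    also have "\<dots> \<le> 2 * k * dist (f y) (f x)" using dk by (intro mult_right_mono) auto
    finally show "dist y x \<le> 2 * k * dist (f y) (f x)" .
  qed (use that dk bdd in \<open>auto intro: bounded_Int\<close>)
  have near: "\<exists>y\<in>X. dist w (f y) < s" if "infdist w (f ` X) < s" for w s
    using that X(2) by (auto elim: infdist_lessE)
  have fib: "G w \<subseteq> (\<lambda>y. g y w) ` preimage_map f X (f y0)" if y0: "y0 \<in> X" "dist w (f y0) < r" for w y0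
  proof
    fix u assume "u \<in> G w"
    then obtain x where x: "x \<in> X" "dist w (f x) < r" "u = g x w" by (auto simp: G_def)
    obtain y where y: "y \<in> X" "f y = f y0" "g x w = g y w"
      using transfer[OF x(1) y0(1) x(2) y0(2)] x(2) y0(2) by metis
    then have "y \<in> preimage_map f X (f y0)" by (simp add: preimage_map_def)
    then show "u \<in> (\<lambda>y. g y w) ` preimage_map f X (f y0)" using x(3) y(3) by blast
  qed
  have fin: "finite (preimage_map f X z)" if "z \<in> f ` X" for z
    using card[OF that] p by (auto intro: card_ge_0_finite)
  have card_G: "finite (G w) \<and> card (G w) \<le> p" if w: "infdist w (f ` X) < r" for w
  proof -
    obtain y where y: "y \<in> X" "dist w (f y) < r" using near[OF w] by auto
    have z: "f y \<in> f ` X" using y by auto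
    from fib[OF y] fin[OF z] have "finite (G w)" "card (G w) \<le> card (preimage_map f X (f y))"
      by (auto intro: finite_subset surj_card_le)
    with card[OF z] show ?thesis by simp
  qed
  have G_f: "G (f y0) = preimage_map f X (f y0)" if "y0 \<in> X" for y0
  proof
    have "g y (f y0) = y" if "y \<in> preimage_map f X (f y0)" for y
      using g_f[of y] that by (simp add: preimage_map_def)
    then show "G (f y0) \<subseteq> preimage_map f X (f y0)"
      using fib[OF that, of "f y0"] r(1) by force
    show "preimage_map f X (f y0) \<subseteq> G (f y0)"
      using r(1) g_f by (force simp: G_def preimage_map_def image_iff)
  qed
  obtain B where B: "B > 0" "\<And>x. x \<in> X \<Longrightarrow> norm x \<le> B" using bdd by (auto simp: bounded_pos)
  \<comment> \<open>If \<open>a\<close> is within \<open>2 * s\<close> of an image point and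
    \<open>b\<close> within \<open>s\<close> of \<open>a\<close>, that image point is within
    \<open>3 * s < r\<close> of both.\<close>
  define s where "s = r / 4"
  have s: "s > 0" "r = 4 * s" using r by (auto simp: s_def)
  define F where "F = (\<lambda>w. if infdist w (f ` X) < 2 * s
      then (*\<^sub>R) (max 0 (1 - infdist w (f ` X) / s)) ` G w else {0})"
  have "lipschitz_set_valued_on UNIV F"
    unfolding F_def
  proof (rule lipschitz_set_valued_cutoff)
    show "s > 0" by (rule s)
    show "real DIM('a) * (2 * k) > 0" using dk by simp
    show "real DIM('a) * (B + 2 * k * r) > 0" using B dk r by (simp add: add_pos_pos)
    show "G w \<noteq> {}" if "infdist w (f ` X) < 2 * s" for w
      using near[of w r] that s by (auto simp: G_def)
    show "norm u \<le> real DIM('a) * (B + 2 * k * r)" if "u \<in> G w" for w u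
      using that B(2) dk unfolding G_def g_def
      by (auto intro!: norm_mcshane_inverse_le)
    show "\<exists>v\<in>G b. dist u v \<le> real DIM('a) * (2 * k) * dist a b"
      if ab: "infdist a (f ` X) < 2 * s" "dist a b < s" and u: "u \<in> G a" for a b u
    proof -
      obtain y0 where y0: "y0 \<in> X" "dist a (f y0) < 2 * s" using near[OF ab(1)] by auto
      obtain x where x: "x \<in> X" "dist a (f x) < r" "u = g x a" using u by (auto simp: G_def)
      have a: "dist a (f y0) < r" and b: "dist b (f y0) < r"
        using y0 ab(2) s dist_triangle3[of b "f y0" a] by auto
      \<comment> \<open>The original base point \<open>x\<close> may be too far from
        \<open>b\<close>; rewriting \<open>u\<close> over the fibre of \<open>f y0\<close> gives one
        branch \<open>g y\<close> that contributes to both \<open>G a\<close> and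
        \<open>G b\<close>.\<close>
      obtain y where y: "y \<in> X" "f y = f y0" "g x a = g y a"
        using transfer[OF x(1) y0(1) x(2) a] a x(2) by metis
      have u': "u = g y a" using x(3) y(3) by simp
      have "dist u (g y b) \<le> real DIM('a) * (2 * k) * dist a b"
        unfolding u' g_def
        using bdd y(1) dk by (intro dist_mcshane_inverse_le) (auto intro: bounded_Int)
      moreover have "g y b \<in> G b" using y b by (auto simp: G_def)
      ultimately show ?thesis by blast
    qed
  qed
  \<comment> \<open>On the image the cut-off factor is 1.\<close>
  moreover have "F z = preimage_map f X z" if "z \<in> f ` X" for z
    using that s G_f by (auto simp: F_def)
  moreover have "finite (F w) \<and> card (F w) \<le> p" for w
  proof (cases "infdist w (f ` X) < 2 * s")
    case True
    then have "infdist w (f ` X) < r" using s by simp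
    from card_G[OF this] True show ?thesis
      unfolding F_def by (auto intro: order_trans[OF card_image_le])
  qed (use p in \<open>auto simp: F_def\<close>)
  ultimately show ?thesis by blast
qed

theorem theorem2:
  fixes T :: "real^'nx \<Rightarrow> real^'nz"
    and X U :: "(real^'nx) set"
    and p :: nat
  assumes "CARD('nx) \<le> CARD('nz)"
    and "compact X"
    and "open U"
    and "X \<subseteq> U"
    and "C1_map_on T U"
    and "p \<ge> 1"
    and "\<forall>z \<in> T ` X. card (preimage_map T X z) = p"
    and "\<forall>x \<in> X. rank (jacobian T (at x)) = CARD('nx)"
  shows "\<exists>Tinv :: real^'nz \<Rightarrow> (real^'nx) set.
           lipschitz_set_valued_on UNIV Tinv \<and>
           (\<forall>z \<in> T ` X. Tinv z = preimage_map T X z) \<and>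
           (\<forall>z. finite (Tinv z) \<and> card (Tinv z) \<le> p)"
proof (cases "X = {}")
  case True
  \<comment> \<open>Two empty sets have Hausdorff distance 0, so the constant empty map is
    Lipschitz.\<close>
  then show ?thesis
    by (intro exI[of _ "\<lambda>_. {}"]) (auto intro: lipschitz_set_valuedI[of 1])
next
  case False
  have cont: "continuous_on X T"
    using assms(4,5) by (meson C1_map_on_def continuous_on_subset differentiable_imp_continuous_on)
  have "\<exists>r>0. \<exists>c>0. \<forall>a\<in>ball x r. \<forall>b\<in>ball x r. c * dist a b \<le> dist (T a) (T b)"
    if "x \<in> X" for x
    using C1_immersion_locally_expanding_at[OF assms(5), of x] assms(4,8) that by (metis subsetD)
  then obtain d k where dk: "0 < d" "0 < k"
    "\<And>x y. x \<in> X \<Longrightarrow> y \<in> X \<Longrightarrow> dist x y \<le> d \<Longrightarrow> dist x y \<le> k * dist (T x) (T y)"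
    using uniformly_locally_expanding[OF assms(2)] by metis
  show ?thesis
    using lipschitz_extension_of_fibres[OF assms(2) False cont dk assms(6)] assms(7) by blast
qed

end
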